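(* Let $\alpha,\sigma,\lambda,f,g^2,t_\lambda,\epsilon_\theta$ be as in the context. Let $s\in(0,T]$, let $x_s\in\mathbb{R}^D$, and let $\tau\mapsto x_\tau$, $\tau\in[0,s]$, be a solution of the diffusion ODE $$\frac{\mathrm{d}x_\tau}{\mathrm{d}\tau}=f(\tau)\,x_\tau+\frac{g^2(\tau)}{2\sigma_\tau}\,\epsilon_\theta(x_\tau,\tau)$$ on $[0,s]$ that takes the given value $x_s$ at time $s$. For $\lambda\in[\lambda_s,\lambda_0]$ write $\hat x_\lambda:=x_{t_\lambda(\lambda)}$ and $\hat\epsilon_\theta(\hat x_\lambda,\lambda):=\epsilon_\theta(x_{t_\lambda(\lambda)},t_\lambda(\lambda))$, and assume that $\lambda\mapsto\hat\epsilon_\theta(\hat x_\lambda,\lambda)$ is continuous on $[\lambda_s,\lambda_0]$. Then for every $t\in[0,s]$, $$x_t=\frac{\alpha_t}{\alpha_s}\,x_s-\alpha_t\int_{\lambda_s}^{\lambda_t}e^{-\lambda}\,\hat\epsilon_\theta(\hat x_\lambda,\lambda)\,\mathrm{d}\lambda .$$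
   Context: Fix $T>0$ and $D\ge 1$. The noise schedule consists of differentiable functions $\alpha,\sigma:[0,T]\to(0,\infty)$ with bounded derivatives, written $\alpha_t=\alpha(t)$, $\sigma_t=\sigma(t)$, such that the signal-to-noise ratio $\alpha_t^2/\sigma_t^2$ is strictly decreasing in $t$. Define $$f(t)=\frac{\mathrm{d}\log\alpha_t}{\mathrm{d}t},\qquad g^2(t)=\frac{\mathrm{d}\sigma_t^2}{\mathrm{d}t}-2\,\frac{\mathrm{d}\log\alpha_t}{\mathrm{d}t}\,\sigma_t^2 .$$ Let $\lambda_t=\lambda(t):=\log(\alpha_t/\sigma_t)$ (half of the log signal-to-noise ratio). It is a strictly decreasing function of $t$, so it has an inverse function $t_\lambda(\cdot):[\lambda_T,\lambda_0]\to[0,T]$ with $t=t_\lambda(\lambda(t))$. The noise prediction model is a function $\epsilon_\theta:\mathbb{R}^D\times[0,T]\to\mathbb{R}^D$ (a neural network with fixed parameters $\theta$). Time runs backwards: the ODE is solved from time $s$ down to $t\le s$, so $\lambda_t\ge\lambda_s$. *)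

theory Defs
  imports "HOL-Analysis.Analysis"
begin

text \<open>
  Functions on $[0,T]$ are total functions on the reals of which only the values on
  \<open>{0..T}\<close> matter.  All time derivatives are taken within \<open>{0..T}\<close>, hence are one-sided
  at the two endpoints.
\<close>

definition noise_schedule :: "real \<Rightarrow> (real \<Rightarrow> real) \<Rightarrow> (real \<Rightarrow> real) \<Rightarrow> bool" where
  "noise_schedule T \<alpha> \<sigma> \<longleftrightarrow>
     (\<forall>t\<in>{0..T}. 0 < \<alpha> t) \<and> (\<forall>t\<in>{0..T}. 0 < \<sigma> t) \<and>
     \<alpha> differentiable_on {0..T} \<and> \<sigma> differentiable_on {0..T} \<and>
     bounded ((\<lambda>t. vector_derivative \<alpha> (at t within {0..T})) ` {0..T}) \<and>
     bounded ((\<lambda>t. vector_derivative \<sigma> (at t within {0..T})) ` {0..T}) \<and>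
     strict_antimono_on {0..T} (\<lambda>t. (\<alpha> t)\<^sup>2 / (\<sigma> t)\<^sup>2)"

definition drift_coeff :: "real \<Rightarrow> (real \<Rightarrow> real) \<Rightarrow> real \<Rightarrow> real" where
  "drift_coeff T \<alpha> t = vector_derivative (\<lambda>u. ln (\<alpha> u)) (at t within {0..T})"

text \<open>This is the quantity written $g^2(t)$; no function $g$ is introduced.\<close>

definition diffusion_coeff_sq :: "real \<Rightarrow> (real \<Rightarrow> real) \<Rightarrow> (real \<Rightarrow> real) \<Rightarrow> real \<Rightarrow> real" where
  "diffusion_coeff_sq T \<alpha> \<sigma> t =
     vector_derivative (\<lambda>u. (\<sigma> u)\<^sup>2) (at t within {0..T})
     - 2 * vector_derivative (\<lambda>u. ln (\<alpha> u)) (at t within {0..T}) * (\<sigma> t)\<^sup>2"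

definition half_log_snr :: "(real \<Rightarrow> real) \<Rightarrow> (real \<Rightarrow> real) \<Rightarrow> real \<Rightarrow> real" where
  "half_log_snr \<alpha> \<sigma> t = ln (\<alpha> t / \<sigma> t)"

definition time_of :: "real \<Rightarrow> (real \<Rightarrow> real) \<Rightarrow> (real \<Rightarrow> real) \<Rightarrow> real \<Rightarrow> real" where
  "time_of T \<alpha> \<sigma> = the_inv_into {0..T} (half_log_snr \<alpha> \<sigma>)"

definition solves_diffusion_ode ::
  "real \<Rightarrow> (real \<Rightarrow> real) \<Rightarrow> (real \<Rightarrow> real) \<Rightarrow> (real ^ 'n \<Rightarrow> real \<Rightarrow> real ^ 'n) \<Rightarrow>
     real \<Rightarrow> (real \<Rightarrow> real ^ 'n) \<Rightarrow> bool" where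
  "solves_diffusion_ode T \<alpha> \<sigma> \<epsilon> s x \<longleftrightarrow>
     (\<forall>\<tau>\<in>{0..s}.
        (x has_vector_derivative
           (drift_coeff T \<alpha> \<tau> *\<^sub>R x \<tau>
            + (diffusion_coeff_sq T \<alpha> \<sigma> \<tau> / (2 * \<sigma> \<tau>)) *\<^sub>R \<epsilon> (x \<tau>) \<tau>))
        (at \<tau> within {0..s}))"

definition x_hat ::
  "real \<Rightarrow> (real \<Rightarrow> real) \<Rightarrow> (real \<Rightarrow> real) \<Rightarrow> (real \<Rightarrow> real ^ 'n) \<Rightarrow> real \<Rightarrow> real ^ 'n" where
  "x_hat T \<alpha> \<sigma> x l = x (time_of T \<alpha> \<sigma> l)"

definition eps_hat ::
  "real \<Rightarrow> (real \<Rightarrow> real) \<Rightarrow> (real \<Rightarrow> real) \<Rightarrow> (real ^ 'n \<Rightarrow> real \<Rightarrow> real ^ 'n) \<Rightarrow>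
     real ^ 'n \<Rightarrow> real \<Rightarrow> real ^ 'n" where
  "eps_hat T \<alpha> \<sigma> \<epsilon> y l = \<epsilon> y (time_of T \<alpha> \<sigma> l)"

end

theory Submission
  imports Defs
begin

text \<open>
  Variation of constants.  Since $g^2 = 2\sigma\sigma' - 2f\sigma^2 = -2\sigma^2\lambda'$ and
  $\sigma/\alpha = e^{-\lambda}$, the quotient $x/\alpha$ has derivative
  $-\lambda' e^{-\lambda}\hat\epsilon$.  The integral from $\lambda_s$ to $\lambda_\tau$, as a
  function of $\tau$, has the opposite derivative by the fundamental theorem of calculus and the
  chain rule, so the sum of the two is constant on $[0,s]$.  The chain rule needs no regularity
  of $\lambda'$, which need not be continuous.
\<close>

lemma noise_scheduleD:
  assumes "noise_schedule T \<alpha> \<sigma>" "t \<in> {0..T}"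
  shows "0 < \<alpha> t" "0 < \<sigma> t"
    "(\<alpha> has_real_derivative vector_derivative \<alpha> (at t within {0..T})) (at t within {0..T})"
    "(\<sigma> has_real_derivative vector_derivative \<sigma> (at t within {0..T})) (at t within {0..T})"
  using assms
  by (auto simp: noise_schedule_def differentiable_on_def has_real_derivative_iff_has_vector_derivative
      vector_derivative_works[symmetric])

text \<open>The schedule compares squared ratios; since both ratios are positive, the comparison
  passes to the ratios themselves and then through \<open>ln\<close>.\<close>

lemma half_log_snr_strict_antimono:
  assumes "noise_schedule T \<alpha> \<sigma>"
  shows "strict_antimono_on {0..T} (half_log_snr \<alpha> \<sigma>)"
proof (rule monotone_onI)
  fix u v assume uv: "u \<in> {0..T}" "v \<in> {0..T}" "u < v"
  have "(\<alpha> v / \<sigma> v)\<^sup>2 < (\<alpha> u / \<sigma> u)\<^sup>2"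
    using assms uv by (auto simp: noise_schedule_def monotone_on_def power_divide)
  moreover have pos: "0 < \<alpha> u / \<sigma> u" "0 < \<alpha> v / \<sigma> v"
    using uv noise_scheduleD[OF assms] by simp_all
  ultimately have "\<alpha> v / \<sigma> v < \<alpha> u / \<sigma> u"
    by (meson less_imp_le power_less_imp_less_base)
  with pos show "half_log_snr \<alpha> \<sigma> v < half_log_snr \<alpha> \<sigma> u"
    by (simp add: half_log_snr_def)
qed

lemma half_log_snr_antimono:
  assumes "noise_schedule T \<alpha> \<sigma>" "u \<in> {0..T}" "v \<in> {0..T}" "u \<le> v"
  shows "half_log_snr \<alpha> \<sigma> v \<le> half_log_snr \<alpha> \<sigma> u"
  using monotone_onD[OF half_log_snr_strict_antimono[OF assms(1)] assms(2,3)] assms(4)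
  by (cases "u = v") auto

lemma time_of_half_log_snr:
  assumes "noise_schedule T \<alpha> \<sigma>" "t \<in> {0..T}"
  shows "time_of T \<alpha> \<sigma> (half_log_snr \<alpha> \<sigma> t) = t"
proof -
  have "inj_on (half_log_snr \<alpha> \<sigma>) {0..T}"
    by (rule linorder_inj_onI')
      (use monotone_onD[OF half_log_snr_strict_antimono[OF assms(1)]] in force)
  then show ?thesis
    unfolding time_of_def using assms(2) by (rule the_inv_into_f_f)
qed

lemma exp_minus_half_log_snr:
  assumes "noise_schedule T \<alpha> \<sigma>" "t \<in> {0..T}"
  shows "exp (- half_log_snr \<alpha> \<sigma> t) = \<sigma> t / \<alpha> t"
  using noise_scheduleD(1,2)[OF assms] by (simp add: half_log_snr_def exp_minus)

text \<open>Logarithmic differentiation. As \<open>0 < T\<close>, the interval is nondegenerate, so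
  a derivative within it is unique and \<open>vector_derivative\<close> returns it, also at the
  endpoints.\<close>

lemma drift_coeff_eq:
  assumes "0 < T" "noise_schedule T \<alpha> \<sigma>" "t \<in> {0..T}"
  shows "drift_coeff T \<alpha> t = vector_derivative \<alpha> (at t within {0..T}) / \<alpha> t"
proof -
  have "((\<lambda>u. ln (\<alpha> u)) has_real_derivative vector_derivative \<alpha> (at t within {0..T}) / \<alpha> t)
      (at t within {0..T})"
    using noise_scheduleD[OF assms(2,3)] by (auto intro!: derivative_eq_intros)
  then show ?thesis
    unfolding drift_coeff_def using assms
    by (auto simp: has_real_derivative_iff_has_vector_derivative
        intro: vector_derivative_within_closed_interval)
qed

lemma half_log_snr_has_real_derivative:
  assumes "0 < T" "noise_schedule T \<alpha> \<sigma>" "t \<in> {0..T}"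
  shows "(half_log_snr \<alpha> \<sigma> has_real_derivative
      drift_coeff T \<alpha> t - vector_derivative \<sigma> (at t within {0..T}) / \<sigma> t) (at t within {0..T})"
  unfolding half_log_snr_def[abs_def] drift_coeff_eq[OF assms]
  using noise_scheduleD[OF assms(2,3)]
  by (auto intro!: derivative_eq_intros simp: field_simps power2_eq_square)

text \<open>The bracket is the derivative of \<open>half_log_snr\<close>. This form turns the noise
  coefficient of the ODE into a multiple of that derivative, ready for the change of variable from
  time to \<lambda>.\<close>

lemma diffusion_coeff_sq_eq:
  assumes "0 < T" "noise_schedule T \<alpha> \<sigma>" "t \<in> {0..T}"
  shows "diffusion_coeff_sq T \<alpha> \<sigma> t =
    - 2 * (\<sigma> t)\<^sup>2 * (drift_coeff T \<alpha> t - vector_derivative \<sigma> (at t within {0..T}) / \<sigma> t)"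
proof -
  have "((\<lambda>u. (\<sigma> u)\<^sup>2) has_real_derivative 2 * \<sigma> t * vector_derivative \<sigma> (at t within {0..T}))
      (at t within {0..T})"
    using noise_scheduleD[OF assms(2,3)] by (auto intro!: derivative_eq_intros)
  then have "vector_derivative (\<lambda>u. (\<sigma> u)\<^sup>2) (at t within {0..T}) =
      2 * \<sigma> t * vector_derivative \<sigma> (at t within {0..T})"
    using assms by (auto simp: has_real_derivative_iff_has_vector_derivative
        intro: vector_derivative_within_closed_interval)
  then show ?thesis
    using noise_scheduleD(2)[OF assms(2,3)]
    by (simp add: diffusion_coeff_sq_def drift_coeff_def field_simps power2_eq_square)
qed

theorem proposition3p1:
  fixes T s t :: real
    and \<alpha> \<sigma> :: "real \<Rightarrow> real"
    and \<epsilon> :: "real ^ 'n \<Rightarrow> real \<Rightarrow> real ^ 'n"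
    and x :: "real \<Rightarrow> real ^ 'n"
    and xs :: "real ^ 'n"
  assumes "0 < T"
    and "noise_schedule T \<alpha> \<sigma>"
    and "s \<in> {0<..T}"
    and "solves_diffusion_ode T \<alpha> \<sigma> \<epsilon> s x"
    and "x s = xs"
    and "continuous_on {half_log_snr \<alpha> \<sigma> s..half_log_snr \<alpha> \<sigma> 0}
           (\<lambda>l. eps_hat T \<alpha> \<sigma> \<epsilon> (x_hat T \<alpha> \<sigma> x l) l)"
    and "t \<in> {0..s}"
  shows "x t = (\<alpha> t / \<alpha> s) *\<^sub>R xs
           - \<alpha> t *\<^sub>R integral {half_log_snr \<alpha> \<sigma> s..half_log_snr \<alpha> \<sigma> t}
               (\<lambda>l. exp (- l) *\<^sub>R eps_hat T \<alpha> \<sigma> \<epsilon> (x_hat T \<alpha> \<sigma> x l) l)"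
proof -
  define L where "L = half_log_snr \<alpha> \<sigma>"
  define h where "h = (\<lambda>l. exp (- l) *\<^sub>R eps_hat T \<alpha> \<sigma> \<epsilon> (x_hat T \<alpha> \<sigma> x l) l)"
  \<comment> \<open>Time runs backwards, so \<open>L s\<close> is the least value of
    \<open>L\<close> on \<open>{0..s}\<close> and serves as the fixed lower limit.\<close>
  define G where "G = (\<lambda>l. integral {L s..l} h)"
  define \<Phi> where "\<Phi> = (\<lambda>\<tau>. (1 / \<alpha> \<tau>) *\<^sub>R x \<tau> + G (L \<tau>))"
  note noise = assms(2)
  \<comment> \<open>The schedule is differentiated within \<open>{0..T}\<close>, the solution within
    \<open>{0..s}\<close>; this inclusion restricts the former to the latter.\<close>
  have sub: "{0..s} \<subseteq> {0..T}" using assms(3) by auto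
  have cont: "continuous_on {L s..L 0} h"
    unfolding h_def using assms(6) by (intro continuous_intros) (simp add: L_def)
  have "(\<Phi> has_vector_derivative 0) (at \<tau> within {0..s})" if \<tau>: "\<tau> \<in> {0..s}" for \<tau>
  proof -
    have \<tau>T: "\<tau> \<in> {0..T}" using \<tau> sub by auto
    note pos = noise_scheduleD(1,2)[OF noise \<tau>T]
    define f where "f = drift_coeff T \<alpha> \<tau>"
    define d where "d = f - vector_derivative \<sigma> (at \<tau> within {0..T}) / \<sigma> \<tau>"
    define e where "e = \<epsilon> (x \<tau>) \<tau>"
    have L_deriv: "(L has_real_derivative d) (at \<tau> within {0..s})"
      unfolding L_def d_def f_def
      by (rule DERIV_subset[OF half_log_snr_has_real_derivative[OF assms(1) noise \<tau>T] sub])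
    have "L \<tau> \<in> {L s..L 0}"
      unfolding L_def using \<tau> \<tau>T assms(3) by (auto intro!: half_log_snr_antimono[OF noise])
    then have "(G has_vector_derivative h (L \<tau>)) (at (L \<tau>) within {L s..L 0})"
      unfolding G_def by (rule integral_has_vector_derivative[OF cont])
    \<comment> \<open>The chain rule asks for the derivative of \<open>G\<close> within the image of
      \<open>L\<close>, while the fundamental theorem gives it within the whole interval.\<close>
    moreover have "L ` {0..s} \<subseteq> {L s..L 0}"
      unfolding L_def using assms(3) by (auto intro!: half_log_snr_antimono[OF noise])
    ultimately have "(G has_vector_derivative h (L \<tau>)) (at (L \<tau>) within L ` {0..s})"
      by (rule has_vector_derivative_within_subset)
    then have GL: "((\<lambda>\<tau>. G (L \<tau>)) has_vector_derivative d *\<^sub>R h (L \<tau>)) (at \<tau> within {0..s})"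
      using vector_diff_chain_within[of L d \<tau> "{0..s}" G] L_deriv
      by (simp add: o_def has_real_derivative_iff_has_vector_derivative)
    \<comment> \<open>\<open>time_of\<close> undoes \<open>L\<close> at \<open>\<tau>\<close>, so
      both hats disappear and the network is evaluated along the solution.\<close>
    have hL: "h (L \<tau>) = (\<sigma> \<tau> / \<alpha> \<tau>) *\<^sub>R e"
      by (simp add: h_def L_def e_def eps_hat_def x_hat_def time_of_half_log_snr[OF noise \<tau>T]
          exp_minus_half_log_snr[OF noise \<tau>T])
    have "(\<alpha> has_real_derivative f * \<alpha> \<tau>) (at \<tau> within {0..s})"
      using DERIV_subset[OF noise_scheduleD(3)[OF noise \<tau>T] sub] pos
      by (simp add: f_def drift_coeff_eq[OF assms(1) noise \<tau>T])
    then have \<alpha>_deriv: "((\<lambda>\<tau>. 1 / \<alpha> \<tau>) has_real_derivative - f / \<alpha> \<tau>) (at \<tau> within {0..s})"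
      using pos by (auto intro!: derivative_eq_intros simp: field_simps)
    \<comment> \<open>Dividing \<open>- 2 * (\<sigma> \<tau>)\<^sup>2 * d\<close> by
      \<open>2 * \<sigma> \<tau>\<close> leaves \<open>- \<sigma> \<tau> * d\<close>.\<close>
    have x_deriv: "(x has_vector_derivative f *\<^sub>R x \<tau> - (\<sigma> \<tau> * d) *\<^sub>R e) (at \<tau> within {0..s})"
      using assms(4) \<tau> pos
      by (auto simp: solves_diffusion_ode_def diffusion_coeff_sq_eq[OF assms(1) noise \<tau>T]
          f_def[symmetric] d_def[symmetric] e_def[symmetric] power2_eq_square
          dest!: bspec[of _ _ \<tau>])
    have "(\<Phi> has_vector_derivative
        (1 / \<alpha> \<tau>) *\<^sub>R (f *\<^sub>R x \<tau> - (\<sigma> \<tau> * d) *\<^sub>R e) + (- f / \<alpha> \<tau>) *\<^sub>R x \<tau> + d *\<^sub>R h (L \<tau>))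
        (at \<tau> within {0..s})"
      unfolding \<Phi>_def
      by (intro has_vector_derivative_add has_vector_derivative_scaleR \<alpha>_deriv x_deriv GL)
    \<comment> \<open>The two terms in \<open>f\<close> cancel, and by \<open>hL\<close> the noise
      term cancels against \<open>d *\<^sub>R h (L \<tau>)\<close>.\<close>
    then show ?thesis
      by (simp add: hL algebra_simps)
  qed
  then obtain c where c: "\<And>\<tau>. \<tau> \<in> {0..s} \<Longrightarrow> \<Phi> \<tau> = c"
    using has_vector_derivative_zero_constant[of "{0..s}" \<Phi>] by auto
  have "\<Phi> t = \<Phi> s"
    using c assms(3,7) by auto
  \<comment> \<open>\<open>G (L s)\<close> vanishes, being an integral over a single point.\<close>
  then have "(1 / \<alpha> t) *\<^sub>R x t = (1 / \<alpha> s) *\<^sub>R xs - G (L t)"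
    using assms(5) by (simp add: \<Phi>_def G_def algebra_simps)
  moreover have "0 < \<alpha> t"
    using noise_scheduleD(1)[OF noise] assms(7) sub by auto
  ultimately have "x t = \<alpha> t *\<^sub>R ((1 / \<alpha> s) *\<^sub>R xs - G (L t))"
    by (metis divide_self less_irrefl mult.right_neutral scaleR_one scaleR_scaleR times_divide_eq_right)
  then show ?thesis
    by (simp add: G_def h_def L_def scaleR_right_diff_distrib)
qed

end
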